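(* Let $G$ be an abelian Lie group whose identity component $G^0$ has finite index in $G$. Let $S$ be a finitely generated subsemigroup of $G$ which is somewhere dense in $G$, i.e. its closure $\overline{S}$ contains a non-empty open subset of $G$. Then $\overline{S}$ is a subgroup of $G$ and contains $G^0$. *)

theory Defs
  imports "HOL-Analysis.Analysis"
begin

definition locally_euclidean :: "'a topology \<Rightarrow> bool" where
  "locally_euclidean X \<longleftrightarrow>
     (\<exists>n. \<forall>x\<in>topspace X. \<exists>U V. openin X U \<and> x \<in> U \<and> openin (Euclidean_space n) V \<and>
        subtopology X U homeomorphic_space subtopology (Euclidean_space n) V)"

definition abelian_Lie_group :: "'a::{topological_ab_group_add, t2_space} itself \<Rightarrow> bool" where
  "abelian_Lie_group _ \<longleftrightarrow> locally_euclidean (euclidean :: 'a topology)"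

definition identity_component :: "'a::{topological_space, zero} set" where
  "identity_component = connected_component_set UNIV 0"

definition finite_index :: "'a::group_add set \<Rightarrow> bool" where
  "finite_index H \<longleftrightarrow> finite ((\<lambda>x. (\<lambda>h. x + h) ` H) ` UNIV)"

inductive_set semigroup_generated :: "'a::plus set \<Rightarrow> 'a set" for A where
  gen: "a \<in> A \<Longrightarrow> a \<in> semigroup_generated A"
| add: "x \<in> semigroup_generated A \<Longrightarrow> y \<in> semigroup_generated A \<Longrightarrow> x + y \<in> semigroup_generated A"

definition finitely_generated_subsemigroup :: "'a::plus set \<Rightarrow> bool" where
  "finitely_generated_subsemigroup S \<longleftrightarrow> (\<exists>A. finite A \<and> S = semigroup_generated A)"

definition somewhere_dense :: "'a::topological_space set \<Rightarrow> bool" where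
  "somewhere_dense S \<longleftrightarrow> (\<exists>U. open U \<and> U \<noteq> {} \<and> U \<subseteq> closure S)"

definition is_subgroup :: "'a::group_add set \<Rightarrow> bool" where
  "is_subgroup H \<longleftrightarrow> 0 \<in> H \<and> (\<forall>x\<in>H. \<forall>y\<in>H. x + y \<in> H) \<and> (\<forall>x\<in>H. - x \<in> H)"

end

theory Submission
  imports Defs
begin

text \<open>
  Let \<open>T\<close> be the closure of \<open>S\<close> and \<open>u\<close> an interior point of \<open>T\<close>.
  If some \<open>- n u\<close> with \<open>n \<ge> 1\<close> lies in \<open>T\<close>, then \<open>0\<close> is interior to \<open>T\<close>, so
  \<open>T \<inter> - T\<close> is an open subgroup; it contains the identity component, and the finite
  index makes \<open>T\<close> a group. Otherwise \<open>u\<close> is an order unit for the preorder with positive cone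
  \<open>T\<close>, and a Hahn--Banach argument for abelian groups gives a continuous homomorphism \<open>f\<close> to the
  reals that is nonnegative on \<open>T\<close> with \<open>f u = 1\<close>. As \<open>S\<close> is finitely generated, the set \<open>f S\<close>
  has only finitely many points below any bound, so \<open>f\<close> is locally constant in the interior of
  \<open>T\<close>. Hence \<open>f\<close> vanishes on the identity component, which contains a positive multiple
  of \<open>u\<close>: a contradiction.
\<close>

section \<open>Integer multiples\<close>

primrec nat_multiple :: "nat \<Rightarrow> 'a::ab_group_add \<Rightarrow> 'a" where
  "nat_multiple 0 x = 0"
| "nat_multiple (Suc n) x = nat_multiple n x + x"

text \<open>Since \<open>nat\<close> truncates at 0, at most one of the two terms is nonzero, so no
  case split on the sign of \<open>k\<close> is needed.\<close>

definition int_multiple :: "int \<Rightarrow> 'a::ab_group_add \<Rightarrow> 'a" where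
  "int_multiple k x = nat_multiple (nat k) x - nat_multiple (nat (- k)) x"

lemma int_multiple_0 [simp]: "int_multiple 0 x = 0"
  by (simp add: int_multiple_def)

lemma int_multiple_plus_1: "int_multiple (k + 1) x = int_multiple k x + x"
proof (cases "k \<ge> 0")
  case True
  then have "nat (k + 1) = Suc (nat k)" by simp
  with True show ?thesis by (simp add: int_multiple_def)
next
  case False
  then have "nat (- k) = Suc (nat (- (k + 1)))" by simp
  with False show ?thesis by (simp add: int_multiple_def)
qed

lemma int_multiple_minus_1: "int_multiple (k - 1) x = int_multiple k x - x"
  using int_multiple_plus_1[of "k - 1" x] by simp

lemma int_multiple_1 [simp]: "int_multiple 1 x = x"
  using int_multiple_plus_1[of 0 x] by simp

lemma int_multiple_add_left: "int_multiple (j + k) x = int_multiple j x + int_multiple k x"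
proof (induction k rule: int_induct[where k = 0])
  case (step1 k)
  then show ?case
    using int_multiple_plus_1[of "j + k" x] by (simp add: int_multiple_plus_1 add.assoc)
next
  case (step2 k)
  then show ?case
    using int_multiple_minus_1[of "j + k" x] by (simp add: int_multiple_minus_1 add_diff_eq)
qed simp

lemma int_multiple_minus_left: "int_multiple (- k) x = - int_multiple k x"
  using int_multiple_add_left[of "- k" k x] by (simp add: eq_neg_iff_add_eq_0)

lemma int_multiple_diff_left: "int_multiple (j - k) x = int_multiple j x - int_multiple k x"
  using int_multiple_add_left[of j "- k" x] by (simp add: int_multiple_minus_left)

lemma int_multiple_add_right: "int_multiple k (x + y) = int_multiple k x + int_multiple k y"
  by (induction k rule: int_induct[where k = 0])
    (simp_all add: int_multiple_plus_1 int_multiple_minus_1 algebra_simps)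

lemma int_multiple_zero_right [simp]: "int_multiple k 0 = 0"
  using int_multiple_add_right[of k 0 0] by simp

lemma int_multiple_minus_right: "int_multiple k (- x) = - int_multiple k x"
  using int_multiple_add_right[of k "- x" x] by (simp add: eq_neg_iff_add_eq_0)

lemma int_multiple_diff_right: "int_multiple k (x - y) = int_multiple k x - int_multiple k y"
  using int_multiple_add_right[of k x "- y"] by (simp add: int_multiple_minus_right)

lemma int_multiple_mult: "int_multiple (j * k) x = int_multiple j (int_multiple k x)"
  by (induction j rule: int_induct[where k = 0])
    (simp_all add: int_multiple_plus_1 int_multiple_minus_1 int_multiple_add_left
      int_multiple_diff_left distrib_right left_diff_distrib)

lemmas int_multiple_simps =
  int_multiple_add_left int_multiple_minus_left int_multiple_diff_left
  int_multiple_add_right int_multiple_minus_right int_multiple_diff_right int_multiple_mult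

lemma additive_int_multiple:
  fixes f :: "'a::ab_group_add \<Rightarrow> real"
  assumes "Modules.additive f"
  shows "f (int_multiple k x) = of_int k * f x"
proof -
  interpret Modules.additive f by fact
  show ?thesis
    by (induction k rule: int_induct[where k = 0])
      (simp_all add: zero add diff int_multiple_plus_1 int_multiple_minus_1 algebra_simps)
qed

lemma continuous_on_int_multiple:
  "continuous_on A (int_multiple k :: 'a::topological_ab_group_add \<Rightarrow> 'a)"
  by (induction k rule: int_induct[where k = 0])
    (simp_all add: int_multiple_plus_1 int_multiple_minus_1 continuous_intros)

lemma int_multiple_mem:
  assumes "\<And>x y. x \<in> P \<Longrightarrow> y \<in> P \<Longrightarrow> x + y \<in> P" and "x \<in> P" and "k > 0"
  shows "int_multiple k x \<in> P"
  using \<open>k > 0\<close>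
  by (induction k rule: int_gr_induct) (simp_all add: assms int_multiple_plus_1)

section \<open>A Hahn--Banach theorem for abelian groups\<close>

definition is_submonoid :: "'a::monoid_add set \<Rightarrow> bool" where
  "is_submonoid P \<longleftrightarrow> 0 \<in> P \<and> (\<forall>x\<in>P. \<forall>y\<in>P. x + y \<in> P)"

lemma is_submonoid_int_multiple:
  assumes "is_submonoid P" "x \<in> P" "k \<ge> 0"
  shows "int_multiple k x \<in> P"
  using assms int_multiple_mem[of P x k] by (cases "k = 0") (auto simp: is_submonoid_def)

text \<open>The set is the submonoid generated by \<open>P\<close> and \<open>g\<close>; it serves
  as the enlargement of \<open>P\<close> in the maximality argument below.\<close>

lemma is_submonoid_adjoin:
  assumes "is_submonoid (P :: 'a::ab_group_add set)"
  shows "is_submonoid {p + int_multiple a g |p a. p \<in> P \<and> a \<ge> 0}"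
  unfolding is_submonoid_def
proof (intro conjI ballI)
  show "0 \<in> {p + int_multiple a g |p a. p \<in> P \<and> a \<ge> 0}"
    using assms by (auto simp: is_submonoid_def intro!: exI[of _ 0])
next
  fix x y
  assume "x \<in> {p + int_multiple a g |p a. p \<in> P \<and> a \<ge> 0}"
    and "y \<in> {p + int_multiple a g |p a. p \<in> P \<and> a \<ge> 0}"
  then obtain p a q b where "x = p + int_multiple a g" "y = q + int_multiple b g"
    "p \<in> P" "q \<in> P" "a \<ge> 0" "b \<ge> 0"
    by auto
  moreover from this have "x + y = (p + q) + int_multiple (a + b) g"
    by (simp add: int_multiple_simps algebra_simps)
  moreover have "p + q \<in> P"
    using calculation assms by (simp add: is_submonoid_def)
  ultimately show "x + y \<in> {p + int_multiple a g |p a. p \<in> P \<and> a \<ge> 0}"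
    by (metis (mono_tags, lifting) add_nonneg_nonneg mem_Collect_eq)
qed

text \<open>Zorn's lemma gives a maximal submonoid above \<open>T\<close> that avoids all negative
  multiples of \<open>u\<close>. If it contained neither \<open>g\<close> nor \<open>- g\<close>,
  adjoining each of them would produce a negative multiple of \<open>u\<close>; eliminating
  \<open>g\<close> from the two relations puts such a multiple into the submonoid itself.\<close>

lemma exists_total_submonoid:
  fixes T :: "'a::ab_group_add set"
  assumes T: "is_submonoid T"
    and u: "\<And>n. n > 0 \<Longrightarrow> - int_multiple n u \<notin> T"
  obtains P where "is_submonoid P" "T \<subseteq> P" "\<And>g. g \<in> P \<or> - g \<in> P"
    "\<And>n. n > 0 \<Longrightarrow> - int_multiple n u \<notin> P"
proof -
  define \<A> where "\<A> = {P. is_submonoid P \<and> T \<subseteq> P \<and> (\<forall>n>0. - int_multiple n u \<notin> P)}"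
  have "\<exists>M\<in>\<A>. \<forall>X\<in>\<A>. M \<subseteq> X \<longrightarrow> X = M"
  proof (rule subset_Zorn_nonempty)
    show "\<A> \<noteq> {}"
      using T u by (auto simp: \<A>_def)
  next
    fix \<C> assume "\<C> \<noteq> {}" and chain: "subset.chain \<A> \<C>"
    then have sub: "\<C> \<subseteq> \<A>"
      by (simp add: subset.chain_def)
    have "is_submonoid (\<Union>\<C>)"
      unfolding is_submonoid_def
    proof (intro conjI ballI)
      show "0 \<in> \<Union>\<C>"
        using \<open>\<C> \<noteq> {}\<close> sub by (auto simp: \<A>_def is_submonoid_def)
    next
      fix x y assume "x \<in> \<Union>\<C>" "y \<in> \<Union>\<C>"
      then obtain X Y where XY: "X \<in> \<C>" "Y \<in> \<C>" "x \<in> X" "y \<in> Y" by blast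
      then have "X \<subseteq> Y \<or> Y \<subseteq> X"
        using chain by (auto simp: subset_chain_def)
      then have "X \<union> Y \<in> \<C>"
        using XY by (auto simp: sup.absorb1 sup.absorb2)
      moreover have "x + y \<in> X \<union> Y"
        using calculation sub XY(3,4) unfolding \<A>_def is_submonoid_def by blast
      ultimately show "x + y \<in> \<Union>\<C>" by blast
    qed
    then show "\<Union>\<C> \<in> \<A>"
      using \<open>\<C> \<noteq> {}\<close> sub by (auto simp: \<A>_def)
  qed
  then obtain P where "P \<in> \<A>" and max: "\<And>X. X \<in> \<A> \<Longrightarrow> P \<subseteq> X \<Longrightarrow> X = P"
    by blast
  then have P: "is_submonoid P" "T \<subseteq> P" and uP: "\<And>n. n > 0 \<Longrightarrow> - int_multiple n u \<notin> P"
    by (auto simp: \<A>_def)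
  \<comment> \<open>By maximality, adjoining \<open>g\<close> must bring in a forbidden element. The
    coefficient \<open>a\<close> is nonzero there, since otherwise that element would already lie in
    \<open>P\<close>.\<close>
  have ext: "\<exists>p\<in>P. \<exists>a>0. \<exists>n>0. p + int_multiple a g = - int_multiple n u" if "g \<notin> P" for g
  proof -
    let ?Q = "{p + int_multiple a g |p a. p \<in> P \<and> a \<ge> 0}"
    have "p + int_multiple 0 g \<in> ?Q" if "p \<in> P" for p
      using that by blast
    then have "P \<subseteq> ?Q" by auto
    have "0 + int_multiple 1 g \<in> ?Q"
      using P(1) by (fastforce simp only: is_submonoid_def)
    then have "?Q \<noteq> P"
      using that by auto
    then have "?Q \<notin> \<A>"
      using max \<open>P \<subseteq> ?Q\<close> by blast
    then have "\<exists>n>0. - int_multiple n u \<in> ?Q"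
      using \<open>P \<subseteq> ?Q\<close> P is_submonoid_adjoin[OF P(1), of g] unfolding \<A>_def by blast
    then obtain n p a where *: "n > 0" "p \<in> P" "a \<ge> 0" "- int_multiple n u = p + int_multiple a g"
      by auto
    moreover have "a \<noteq> 0"
      using * uP[of n] by auto
    ultimately show ?thesis
      by (metis order_le_less)
  qed
  have "g \<in> P \<or> - g \<in> P" for g
  proof (rule ccontr)
    assume "\<not> (g \<in> P \<or> - g \<in> P)"
    then obtain p a n q b m where
      p: "p \<in> P" "a > 0" "n > 0" "p + int_multiple a g = - int_multiple n u" and
      q: "q \<in> P" "b > 0" "m > 0" "q + int_multiple b (- g) = - int_multiple m u"
      using ext[of g] ext[of "- g"] by blast
    have "p = - int_multiple n u - int_multiple a g" "q = - int_multiple m u + int_multiple b g"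
      using p(4) q(4) by (simp_all add: int_multiple_minus_right algebra_simps)
    \<comment> \<open>Weighting the two relations by \<open>b\<close> and \<open>a\<close> makes the
      multiples of \<open>g\<close> cancel.\<close>
    then have "int_multiple b p + int_multiple a q = - int_multiple (b * n + a * m) u"
      by (simp add: int_multiple_simps flip: int_multiple_mult) (simp add: mult.commute)
    moreover have "int_multiple b p + int_multiple a q \<in> P"
      using P(1) p q is_submonoid_int_multiple[of P] by (simp add: is_submonoid_def)
    moreover have "b * n + a * m > 0"
      using p q by (simp add: add_pos_pos)
    ultimately show False
      using uP by metis
  qed
  with P uP that show thesis by blast
qed

text \<open>\<open>T\<close> is enlarged to the positive cone \<open>P\<close> of a total preorder,
  and \<open>f g\<close> is obtained by comparing multiples of \<open>g\<close> with multiples of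
  \<open>u\<close>. Applying \<open>unit\<close> to \<open>g\<close> and to \<open>- g\<close>
  bounds \<open>g\<close> from both sides, so the supremum is a real number. Additivity holds up to
  an error \<open>2 / n\<close> for every \<open>n\<close>, hence exactly.\<close>

lemma exists_additive_order_unit:
  fixes T :: "'a::ab_group_add set"
  assumes T: "is_submonoid T" "u \<in> T"
    and u: "\<And>n. n > 0 \<Longrightarrow> - int_multiple n u \<notin> T"
    and unit: "\<And>g. \<exists>n k. k > 0 \<and> int_multiple n u + int_multiple k g \<in> T"
  obtains f :: "'a \<Rightarrow> real" where "Modules.additive f" "\<And>x. x \<in> T \<Longrightarrow> f x \<ge> 0" "f u = 1"
proof -
  obtain P where P: "is_submonoid P" "T \<subseteq> P" and tot: "\<And>g. g \<in> P \<or> - g \<in> P"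
    and uP: "\<And>n. n > 0 \<Longrightarrow> - int_multiple n u \<notin> P"
    using exists_total_submonoid[OF T(1) u] by blast
  have Padd: "x + y \<in> P" if "x \<in> P" "y \<in> P" for x y
    using P(1) that by (simp add: is_submonoid_def)
  \<comment> \<open>\<open>L g\<close> and \<open>R g\<close> list the fractions \<open>k / n\<close> below and above \<open>g\<close> in units of \<open>u\<close>; \<open>f g\<close> is the cut
    they determine.\<close>
  define L where "L g = {(k, n). n > 0 \<and> int_multiple n g - int_multiple k u \<in> P}" for g
  define R where "R g = {(k, n). n > 0 \<and> int_multiple k u - int_multiple n g \<in> P}" for g
  define q :: "int \<times> int \<Rightarrow> real" where "q = (\<lambda>(k, n). of_int k / of_int n)"
  define f where "f g = Sup (q ` L g)" for g
  have LR: "q x \<le> q y" if xy: "x \<in> L g" "y \<in> R g" for x y g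
  proof -
    obtain k n k' n' where [simp]: "x = (k, n)" "y = (k', n')" by fastforce
    have pos: "n > 0" "n' > 0" using xy by (auto simp: L_def R_def)
    have "int_multiple n' (int_multiple n g - int_multiple k u) \<in> P"
      "int_multiple n (int_multiple k' u - int_multiple n' g) \<in> P"
      using xy by (auto simp: L_def R_def intro!: is_submonoid_int_multiple P(1))
    \<comment> \<open>Clearing denominators cancels \<open>g\<close> and leaves a multiple of
      \<open>u\<close> in \<open>P\<close>, whose coefficient cannot be negative by
      \<open>uP\<close>.\<close>
    then have "int_multiple n' (int_multiple n g - int_multiple k u)
        + int_multiple n (int_multiple k' u - int_multiple n' g) \<in> P"
      by (rule Padd)
    also have "int_multiple n' (int_multiple n g - int_multiple k u)
        + int_multiple n (int_multiple k' u - int_multiple n' g) = - int_multiple (n' * k - n * k') u"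
      by (simp add: int_multiple_simps flip: int_multiple_mult) (simp add: mult.commute)
    finally have "n' * k \<le> n * k'"
      using uP[of "n' * k - n * k'"] by force
    then have "real_of_int n' * of_int k \<le> of_int n * of_int k'"
      by (metis of_int_le_iff of_int_mult)
    with pos show ?thesis by (simp add: q_def field_simps)
  qed
  have L_ne: "L g \<noteq> {}" for g
  proof -
    obtain n k where "k > 0" "int_multiple n u + int_multiple k g \<in> P"
      using unit[of g] P(2) by blast
    then have "(- n, k) \<in> L g" by (simp add: L_def int_multiple_minus_left add.commute)
    then show ?thesis by blast
  qed
  have R_ne: "R g \<noteq> {}" for g
  proof -
    obtain n k where "k > 0" "int_multiple n u + int_multiple k (- g) \<in> P"
      using unit[of "- g"] P(2) by blast
    then have "(n, k) \<in> R g" by (simp add: R_def int_multiple_minus_right)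
    then show ?thesis by blast
  qed
  have fL: "q x \<le> f g" if "x \<in> L g" for x g
  proof -
    obtain y where "y \<in> R g" using R_ne by blast
    then have "bdd_above (q ` L g)" using LR by (intro bdd_aboveI2) blast
    with that show ?thesis unfolding f_def by (intro cSup_upper) auto
  qed
  have fR: "f g \<le> q x" if "x \<in> R g" for x g
    unfolding f_def using L_ne[of g] LR that by (intro cSup_least) blast+
  have cut: "(k, n) \<in> L g \<or> (k, n) \<in> R g" if "n > 0" for k n g
    using tot[of "int_multiple n g - int_multiple k u"] that by (auto simp: L_def R_def)
  have addL: "(k + k', n) \<in> L (g + h)" if "(k, n) \<in> L g" "(k', n) \<in> L h" for k k' n g h
    using that Padd[of "int_multiple n g - int_multiple k u" "int_multiple n h - int_multiple k' u"]
    by (auto simp: L_def int_multiple_simps algebra_simps)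
  have addR: "(k + k', n) \<in> R (g + h)" if "(k, n) \<in> R g" "(k', n) \<in> R h" for k k' n g h
    using that Padd[of "int_multiple k u - int_multiple n g" "int_multiple k' u - int_multiple n h"]
    by (auto simp: R_def int_multiple_simps algebra_simps)
  \<comment> \<open>The integer is strictly below \<open>n * f g\<close>, so the pair cannot lie in
    \<open>R g\<close>. The floor would not do: if \<open>n * f g\<close> is an integer, the pair
    could lie in \<open>R g\<close> only.\<close>
  have floorL: "(\<lceil>of_int n * f g\<rceil> - 1, n) \<in> L g" if "n > 0" for n g
  proof (rule ccontr)
    assume "\<not> ?thesis"
    then have "f g \<le> q (\<lceil>of_int n * f g\<rceil> - 1, n)" using cut fR that by blast
    then have "of_int n * f g \<le> of_int \<lceil>of_int n * f g\<rceil> - 1"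
      using that by (simp add: q_def field_simps)
    then show False by linarith
  qed
  have floorR: "(\<lfloor>of_int n * f g\<rfloor> + 1, n) \<in> R g" if "n > 0" for n g
  proof (rule ccontr)
    assume "\<not> ?thesis"
    then have "q (\<lfloor>of_int n * f g\<rfloor> + 1, n) \<le> f g" using cut fL that by blast
    then have "of_int n * f g \<ge> of_int \<lfloor>of_int n * f g\<rfloor> + 1"
      using that by (simp add: q_def field_simps)
    then show False by linarith
  qed
  \<comment> \<open>Pairs with the common denominator \<open>n\<close> can be added on either side
    of the cut, and each of the two roundings costs at most 1.\<close>
  have approx: "of_int n * \<bar>f (g + h) - (f g + f h)\<bar> \<le> 2" if "n > 0" for n g h
  proof -
    have "of_int n * f (g + h) \<ge> of_int (\<lceil>of_int n * f g\<rceil> - 1 + (\<lceil>of_int n * f h\<rceil> - 1))"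
      using fL[OF addL[OF floorL[OF that] floorL[OF that]], of g h] that
      by (simp add: q_def field_simps)
    moreover have "of_int n * f (g + h) \<le> of_int (\<lfloor>of_int n * f g\<rfloor> + 1 + (\<lfloor>of_int n * f h\<rfloor> + 1))"
      using fR[OF addR[OF floorR[OF that] floorR[OF that]], of g h] that
      by (simp add: q_def field_simps)
    ultimately have "\<bar>of_int n * f (g + h) - (of_int n * f g + of_int n * f h)\<bar> \<le> 2"
      by linarith
    then have "\<bar>of_int n * (f (g + h) - (f g + f h))\<bar> \<le> 2"
      by (simp add: algebra_simps)
    with that show ?thesis by (simp add: abs_mult)
  qed
  have "f (g + h) = f g + f h" for g h
  proof (rule ccontr)
    assume "f (g + h) \<noteq> f g + f h"
    then have pos: "\<bar>f (g + h) - (f g + f h)\<bar> > 0" by simp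
    obtain N where "of_nat N * \<bar>f (g + h) - (f g + f h)\<bar> > 2"
      using reals_Archimedean3[OF pos] by blast
    moreover from this have "N > 0" by (cases N) auto
    ultimately show False
      using approx[of "int N" g h] by simp
  qed
  then have "Modules.additive f" by (simp add: Modules.additive_def)
  moreover have "f x \<ge> 0" if "x \<in> T" for x
    using fL[of "(0, 1)" x] that P(2) by (auto simp: L_def q_def)
  moreover have "f u = 1"
    using fL[of "(1, 1)" u] fR[of "(1, 1)" u] P(1)
    by (auto simp: L_def R_def q_def is_submonoid_def)
  ultimately show thesis using that by blast
qed

section \<open>Topological abelian groups\<close>

lemma open_translation:
  fixes U :: "'a::topological_ab_group_add set"
  assumes "open U"
  shows "open {x. a + x \<in> U}"
  using open_vimage[OF assms, of "\<lambda>x. a + x"] by (simp add: vimage_def continuous_intros)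

text \<open>A translate \<open>a + N\<close> lies entirely in \<open>K\<close> or entirely outside
  it, according to whether \<open>a\<close> does. So \<open>K\<close> is both open and closed, and a
  connected set through 0 cannot leave it.\<close>

lemma identity_component_subset:
  fixes K :: "'a::topological_ab_group_add set"
  assumes K: "is_subgroup K" and N: "open N" "0 \<in> N" "N \<subseteq> K"
  shows "identity_component \<subseteq> K"
proof -
  have diff: "x - y \<in> K" if "x \<in> K" "y \<in> K" for x y
    using K that unfolding is_subgroup_def by (metis add_uminus_conv_diff)
  have nbhd: "x \<in> K \<longleftrightarrow> a \<in> K" if "- a + x \<in> N" for a x
  proof -
    have "- a + x \<in> K" using that N by blast
    then show ?thesis
      using diff[of x "- a + x"] K unfolding is_subgroup_def
      by (metis add.commute add_diff_cancel_left' add_uminus_conv_diff diff_add_cancel)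
  qed
  have open_nbhd: "open {x. - a + x \<in> N}" "a \<in> {x. - a + x \<in> N}" for a
    using open_translation[OF N(1), of "- a"] N(2) by simp_all
  have "open K"
  proof (subst open_subopen, intro ballI)
    fix a assume "a \<in> K"
    then have "{x. - a + x \<in> N} \<subseteq> K" using nbhd by blast
    then show "\<exists>W. open W \<and> a \<in> W \<and> W \<subseteq> K" using open_nbhd by blast
  qed
  moreover have "open (- K)"
  proof (subst open_subopen, intro ballI)
    fix a assume "a \<in> - K"
    then have "{x. - a + x \<in> N} \<subseteq> - K" using nbhd by blast
    then show "\<exists>W. open W \<and> a \<in> W \<and> W \<subseteq> - K" using open_nbhd by blast
  qed
  moreover have "0 \<in> K" using N by blast
  moreover have "connected (identity_component :: 'a set)" "(0::'a) \<in> identity_component"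
    by (simp_all add: identity_component_def connected_connected_component)
  ultimately show ?thesis
    using connectedD[of identity_component K "- K"] by blast
qed

text \<open>By the pigeonhole principle two translates of \<open>H\<close> by multiples
  \<open>i\<close> and \<open>j\<close> of \<open>g\<close>, with \<open>i < j\<close>, coincide. As
  0 is in \<open>H\<close>, the difference of these multiples lies in \<open>H\<close>.\<close>

lemma finite_index_multiple_mem:
  assumes "finite_index (H :: 'a::ab_group_add set)" "0 \<in> H"
  obtains k where "k > 0" "int_multiple k g \<in> H"
proof -
  let ?c = "\<lambda>j::nat. (\<lambda>h. int_multiple (int j) g + h) ` H"
  have "range ?c \<subseteq> (\<lambda>x. (\<lambda>h. x + h) ` H) ` UNIV" by blast
  then have "finite (range ?c)"
    using assms(1) finite_subset unfolding finite_index_def by blast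
  then have "\<not> inj ?c"
    using finite_imageD infinite_UNIV_nat by blast
  then obtain i j where ij: "i < j" "?c i = ?c j"
    unfolding inj_def by (metis linorder_neqE_nat)
  have "int_multiple (int j) g + 0 \<in> ?c j" using assms(2) by blast
  then obtain h where "h \<in> H" "int_multiple (int j) g = int_multiple (int i) g + h"
    using ij by auto
  then have "int_multiple (int j - int i) g \<in> H"
    by (simp add: int_multiple_diff_left)
  with ij that[of "int j - int i"] show thesis by simp
qed

text \<open>Addition is continuous and maps \<open>S \<times> S\<close> into \<open>S\<close>, hence
  the closure of \<open>S \<times> S\<close>, which is the product of the closures, into the closure
  of \<open>S\<close>.\<close>

lemma closure_add_mem:
  fixes S :: "'a::topological_ab_group_add set"
  assumes S: "\<And>x y. x \<in> S \<Longrightarrow> y \<in> S \<Longrightarrow> x + y \<in> S"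
    and "x \<in> closure S" "y \<in> closure S"
  shows "x + y \<in> closure S"
proof -
  have "(\<lambda>p. fst p + snd p) ` closure (S \<times> S) \<subseteq> closure S"
    using S
    by (intro image_closure_subset)
      (auto intro!: continuous_intros closed_closure closure_subset[THEN subsetD])
  with assms(2,3) show ?thesis
    by (force simp: closure_Times)
qed

text \<open>If the \<open>n\<close>-th multiple of \<open>x - a\<close> lies in \<open>N\<close>,
  additivity gives \<open>n * \<bar>f x - f a\<bar> \<le> 1\<close>. Such \<open>x\<close> form a
  neighbourhood of \<open>a\<close>, because taking multiples is continuous.\<close>

lemma additive_continuous_on:
  fixes f :: "'a::topological_ab_group_add \<Rightarrow> real"
  assumes f: "Modules.additive f" and N: "open N" "0 \<in> N" and bd: "\<And>x. x \<in> N \<Longrightarrow> \<bar>f x\<bar> \<le> 1"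
  shows "continuous_on UNIV f"
proof -
  interpret Modules.additive f by fact
  have "(f \<longlongrightarrow> f a) (at a)" for a
  proof (rule tendstoI)
    fix e :: real assume "e > 0"
    then obtain n :: nat where "n > 0" "1 / real n < e"
      by (metis One_nat_def divide_inverse_commute mult.right_neutral nat_approx_posE
          real_arch_inverse zero_less_Suc)
    define W where "W = {x. int_multiple (int n) (- a + x) \<in> N}"
    have "open W"
      unfolding W_def
      using open_translation[OF open_vimage[OF N(1) continuous_on_int_multiple[of UNIV "int n"]], of "- a"]
      by simp
    moreover have "a \<in> W" using N by (simp add: W_def)
    moreover have "dist (f x) (f a) < e" if "x \<in> W" for x
    proof -
      have "real n * \<bar>f x - f a\<bar> \<le> 1"
        using bd[of "int_multiple (int n) (- a + x)"] that additive_int_multiple[OF f]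
        by (simp add: W_def diff abs_mult)
      then have "\<bar>f x - f a\<bar> \<le> 1 / real n"
        using \<open>n > 0\<close> by (simp add: field_simps)
      with \<open>1 / real n < e\<close> show ?thesis by (simp add: dist_real_def)
    qed
    ultimately show "\<forall>\<^sub>F x in at a. dist (f x) (f a) < e"
      unfolding eventually_at_topological by blast
  qed
  then show ?thesis by (simp add: continuous_on_def)
qed

section \<open>Finitely generated semigroups of nonnegative reals\<close>

lemma semigroup_generated_sum:
  assumes "finite A" "x \<in> semigroup_generated A" and f: "Modules.additive (f :: 'a::ab_group_add \<Rightarrow> real)"
  shows "\<exists>k. f x = (\<Sum>a\<in>A. of_nat (k a) * f a)"
  using assms(2)
proof induction
  case (gen a)
  have "f a = (\<Sum>b\<in>A. of_nat (if b = a then 1 else 0) * f b)"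
    using gen \<open>finite A\<close> by (simp add: if_distrib if_distribR cong: if_cong)
  then show ?case by (rule exI[of _ "\<lambda>b. if b = a then 1 else 0"])
next
  case (add x y)
  then obtain k l where "f x = (\<Sum>a\<in>A. of_nat (k a) * f a)" "f y = (\<Sum>a\<in>A. of_nat (l a) * f a)"
    by blast
  then have "f (x + y) = (\<Sum>a\<in>A. of_nat (k a + l a) * f a)"
    using f by (simp add: Modules.additive_def sum.distrib distrib_right)
  then show ?case by (rule exI[of _ "\<lambda>a. k a + l a"])
qed

text \<open>A value at most \<open>c\<close> bounds the coefficient of each generator with
  \<open>f a > 0\<close>. Generators with \<open>f a = 0\<close> contribute nothing, so their
  coefficients may be reset to 0, which leaves finitely many coefficient vectors.\<close>

lemma finite_bounded_semigroup_values:
  fixes f :: "'a::ab_group_add \<Rightarrow> real"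
  assumes A: "finite A" and f: "Modules.additive f" and nonneg: "\<And>a. a \<in> A \<Longrightarrow> f a \<ge> 0"
  shows "finite (f ` semigroup_generated A \<inter> {..c})"
proof -
  \<comment> \<open>One bound for all coefficients: the sum dominates each of its terms.\<close>
  define N where "N = (\<Sum>a\<in>A. nat \<lceil>c / f a\<rceil>)"
  have "f ` semigroup_generated A \<inter> {..c}
      \<subseteq> (\<lambda>k. \<Sum>a\<in>A. of_nat (k a) * f a) ` (A \<rightarrow>\<^sub>E {..N})"
  proof
    fix y assume "y \<in> f ` semigroup_generated A \<inter> {..c}"
    then obtain k where y: "y = (\<Sum>a\<in>A. of_nat (k a) * f a)" "y \<le> c"
      using semigroup_generated_sum[OF A _ f] by auto
    define l where "l = (\<lambda>a\<in>A. if f a = 0 then 0 else k a)"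
    have "l a \<le> N" if a: "a \<in> A" for a
    proof (cases "f a = 0")
      case False
      then have pos: "f a > 0" using nonneg[OF a] by simp
      have "of_nat (k a) * f a \<le> y"
        unfolding y(1) using A a nonneg by (intro member_le_sum) auto
      then have "of_nat (k a) \<le> c / f a"
        using y(2) pos by (simp add: field_simps)
      then have "k a \<le> nat \<lceil>c / f a\<rceil>" by linarith
      also have "\<dots> \<le> N"
        unfolding N_def using A a by (intro member_le_sum) auto
      finally show ?thesis using a by (simp add: l_def)
    qed (use a in \<open>simp add: l_def\<close>)
    then have "l \<in> A \<rightarrow>\<^sub>E {..N}" by (auto simp: l_def)
    moreover have "y = (\<Sum>a\<in>A. of_nat (l a) * f a)"
      unfolding y(1) by (intro sum.cong) (auto simp: l_def)
    ultimately show "y \<in> (\<lambda>k. \<Sum>a\<in>A. of_nat (k a) * f a) ` (A \<rightarrow>\<^sub>E {..N})" by blast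
  qed
  then show ?thesis
    by (rule finite_subset) (simp add: A finite_PiE)
qed

text \<open>By continuity the values of \<open>f\<close> near \<open>u\<close> stay in a finite set,
  so \<open>f\<close> is constant near \<open>u\<close>. Translation by \<open>- u\<close> then
  shows that the kernel of \<open>f\<close> contains a neighbourhood of 0, and hence the identity
  component.\<close>

lemma additive_vanishes_on_identity_component:
  fixes f :: "'a::topological_ab_group_add \<Rightarrow> real"
  assumes A: "finite A" and f: "Modules.additive f" "continuous_on UNIV f"
    and nonneg: "\<And>a. a \<in> A \<Longrightarrow> f a \<ge> 0"
    and U: "open U" "u \<in> U" "U \<subseteq> closure (semigroup_generated A)"
    and g: "g \<in> identity_component"
  shows "f g = 0"
proof -
  interpret Modules.additive f by fact
  \<comment> \<open>The cutoff only has to exceed \<open>f u\<close>, so that it is not reached near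
    \<open>u\<close>.\<close>
  define F where "F = f ` semigroup_generated A \<inter> {..f u + 1}"
  have "finite F"
    unfolding F_def by (rule finite_bounded_semigroup_values[OF A f(1) nonneg])
  have "closure (semigroup_generated A) \<subseteq> f -` (F \<union> {f u + 1..})"
  proof (rule closure_minimal)
    show "semigroup_generated A \<subseteq> f -` (F \<union> {f u + 1..})"
      by (auto simp: F_def)
    show "closed (f -` (F \<union> {f u + 1..}))"
      using \<open>finite F\<close> f(2) by (intro closed_vimage closed_Un) (auto intro: finite_imp_closed)
  qed
  then have FU: "f x \<in> F \<or> f x \<ge> f u + 1" if "x \<in> U" for x
    using that U by auto
  \<comment> \<open>Below the cutoff only the finitely many values in \<open>F\<close> can occur on
    \<open>U\<close>; all of them except \<open>f u\<close> are removed.\<close>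
  define W where "W = U \<inter> f -` ({..<f u + 1} - (F - {f u}))"
  have "open W"
    unfolding W_def using \<open>finite F\<close> f(2) U(1)
    by (intro open_Int open_vimage open_Diff finite_imp_closed) auto
  moreover have "u \<in> W" using U by (simp add: W_def)
  moreover have "f x = f u" if "x \<in> W" for x
    using FU[of x] that by (auto simp: W_def)
  ultimately have "open {x. u + x \<in> W}" "0 \<in> {x. u + x \<in> W}" "{x. u + x \<in> W} \<subseteq> {x. f x = 0}"
    using open_translation[of W u] by (auto, metis add add_cancel_left_right)
  moreover have "is_subgroup {x. f x = 0}"
    by (simp add: is_subgroup_def zero add minus)
  ultimately show ?thesis
    using identity_component_subset g by blast
qed

section \<open>Closures of somewhere dense semigroups\<close>

text \<open>The intersection of \<open>T\<close> with \<open>- T\<close> is a subgroup containing a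
  neighbourhood of 0, so it contains the identity component. Some positive multiple \<open>k\<close>
  of \<open>x\<close> lies there, and \<open>- x\<close> is the sum of minus that multiple and the
  multiple \<open>k - 1\<close> of \<open>x\<close>.\<close>

lemma closed_under_add_is_subgroup:
  fixes T :: "'a::topological_ab_group_add set"
  assumes index: "finite_index (identity_component :: 'a set)"
    and T: "\<And>x y. x \<in> T \<Longrightarrow> y \<in> T \<Longrightarrow> x + y \<in> T"
    and N: "open N" "0 \<in> N" "N \<subseteq> T"
  shows "is_subgroup T \<and> identity_component \<subseteq> T"
proof -
  define K where "K = T \<inter> uminus -` T"
  have "is_subgroup K"
    using T N(2,3) unfolding K_def is_subgroup_def by (auto simp only: Int_iff vimage_eq
      minus_add_distrib minus_minus minus_zero)
  moreover have "open (N \<inter> uminus -` N)"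
    using N(1) by (intro open_Int open_vimage) (auto intro!: continuous_intros)
  ultimately have K: "identity_component \<subseteq> K"
    using N(2,3) by (intro identity_component_subset[where N = "N \<inter> uminus -` N"]) (auto simp: K_def)
  have "- x \<in> T" if "x \<in> T" for x
  proof -
    obtain k where k: "k > 0" "int_multiple k x \<in> identity_component"
      using finite_index_multiple_mem[OF index, of x] by (auto simp: identity_component_def)
    then have "- int_multiple k x \<in> T" using K by (auto simp: K_def)
    moreover have "int_multiple (k - 1) x \<in> T"
      using k(1) that N(2,3) T int_multiple_mem[of T x "k - 1"] by (cases "k = 1") auto
    ultimately have "- int_multiple k x + int_multiple (k - 1) x \<in> T" by (rule T)
    then show ?thesis by (simp add: int_multiple_minus_1)
  qed
  then show ?thesis
    using K N(2,3) T by (auto simp: is_subgroup_def K_def)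
qed

text \<open>The elements bounded from both sides by multiples of \<open>u\<close> form a subgroup.
  It contains every \<open>x\<close> with \<open>u + x\<close> and \<open>u - x\<close> in
  \<open>U\<close>, by the multiple 1, hence a neighbourhood of 0.\<close>

lemma interior_point_order_unit:
  fixes T :: "'a::topological_ab_group_add set"
  assumes T: "is_submonoid T" "u \<in> T" and U: "open U" "u \<in> U" "U \<subseteq> T"
    and g: "g \<in> identity_component"
  shows "\<exists>n. int_multiple n u + g \<in> T"
proof -
  define K where "K = {g. \<exists>n. int_multiple n u + g \<in> T \<and> int_multiple n u - g \<in> T}"
  have "0 \<in> K"
    using T unfolding K_def by (auto intro!: exI[of _ 0] simp: is_submonoid_def)
  moreover have "x + y \<in> K" if "x \<in> K" "y \<in> K" for x y
  proof -
    obtain m n where "int_multiple m u + x \<in> T" "int_multiple m u - x \<in> T"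
      "int_multiple n u + y \<in> T" "int_multiple n u - y \<in> T"
      using \<open>x \<in> K\<close> \<open>y \<in> K\<close> by (auto simp: K_def)
    then have "(int_multiple m u + x) + (int_multiple n u + y) \<in> T"
      "(int_multiple m u - x) + (int_multiple n u - y) \<in> T"
      using T(1) by (auto simp: is_submonoid_def)
    then show ?thesis
      unfolding K_def by (auto intro!: exI[of _ "m + n"] simp: int_multiple_add_left algebra_simps)
  qed
  moreover have "- x \<in> K" if "x \<in> K" for x
    using that unfolding K_def by auto
  ultimately have "is_subgroup K" by (simp add: is_subgroup_def)
  moreover have "open ({x. u + x \<in> U} \<inter> uminus -` {x. u + x \<in> U})"
    using open_translation[OF U(1)] by (intro open_Int open_vimage) (auto intro!: continuous_intros)
  moreover have "{x. u + x \<in> U} \<inter> uminus -` {x. u + x \<in> U} \<subseteq> K"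
    using U(3) unfolding K_def by (auto intro!: exI[of _ 1])
  ultimately have "identity_component \<subseteq> K"
    using U(2) by (intro identity_component_subset) auto
  with g show ?thesis by (auto simp: K_def)
qed

lemma somewhere_dense_contains_minus_multiple:
  fixes A :: "'a::topological_ab_group_add set"
  assumes A: "finite A" and index: "finite_index (identity_component :: 'a set)"
    and U: "open U" "u \<in> U" "U \<subseteq> closure (semigroup_generated A)"
  shows "\<exists>n>0. - int_multiple n u \<in> closure (semigroup_generated A)"
proof (rule ccontr)
  let ?T = "closure (semigroup_generated A)"
  assume no: "\<not> ?thesis"
  have add_T: "x + y \<in> ?T" if "x \<in> ?T" "y \<in> ?T" for x y
    using closure_add_mem that by (metis semigroup_generated.add)
  have uT: "u \<in> ?T" using U by blast
  have mult_T: "int_multiple n u \<in> ?T" if "n > 0" for n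
    using int_multiple_mem[of ?T, OF add_T uT that] .
  \<comment> \<open>The closure is not known to contain 0, so 0 is adjoined to get a
    submonoid.\<close>
  define T where "T = insert 0 ?T"
  have T: "is_submonoid T" "u \<in> T" "U \<subseteq> T"
    using add_T uT U by (auto simp: T_def is_submonoid_def)
  \<comment> \<open>The new element 0 does no harm: if the multiple were 0, it would equal its own
    negative, yet \<open>mult_T\<close> puts it into the closure.\<close>
  have "- int_multiple n u \<notin> T" if "n > 0" for n
    using no that mult_T[OF that] by (auto simp: T_def)
  moreover have comp: "\<exists>k>0. int_multiple k g \<in> identity_component" for g :: 'a
    using finite_index_multiple_mem[OF index, of g] by (auto simp: identity_component_def)
  \<comment> \<open>A suitable positive multiple of \<open>g\<close> lies in the identity component,
    where \<open>u\<close> is already known to be an order unit.\<close>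
  moreover have "\<exists>n k. k > 0 \<and> int_multiple n u + int_multiple k g \<in> T" for g
    using comp[of g] interior_point_order_unit[OF T(1,2) U(1,2) T(3)] by blast
  ultimately obtain f :: "'a \<Rightarrow> real" where f: "Modules.additive f" "\<And>x. x \<in> T \<Longrightarrow> f x \<ge> 0" "f u = 1"
    using exists_additive_order_unit[OF T(1,2)] by metis
  interpret Modules.additive f by fact
  \<comment> \<open>For \<open>x\<close> in this symmetric neighbourhood both \<open>u + x\<close>
    and \<open>u - x\<close> lie in \<open>T\<close>, so \<open>f u = 1\<close> bounds the absolute
    value of \<open>f x\<close>.\<close>
  define N where "N = {x. u + x \<in> U} \<inter> uminus -` {x. u + x \<in> U}"
  have "continuous_on UNIV f"
  proof (rule additive_continuous_on[OF f(1)])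
    show "open N"
      unfolding N_def using open_translation[OF U(1)]
      by (intro open_Int open_vimage) (auto intro!: continuous_intros)
    show "0 \<in> N" using U by (simp add: N_def)
    show "\<bar>f x\<bar> \<le> 1" if "x \<in> N" for x
    proof -
      have "u + x \<in> T" "u + - x \<in> T" using that T(3) by (auto simp: N_def)
      then have "f (u + x) \<ge> 0" "f (u + - x) \<ge> 0" by (simp_all only: f(2))
      then show ?thesis by (simp add: add diff f(3))
    qed
  qed
  moreover have "f a \<ge> 0" if "a \<in> A" for a
    using closure_subset[THEN subsetD, OF semigroup_generated.gen[OF that]]
    by (intro f(2)) (simp add: T_def)
  ultimately have vanish: "f g = 0" if "g \<in> identity_component" for g
    using additive_vanishes_on_identity_component[OF A f(1) _ _ U that] by blast
  obtain k where "k > 0" "int_multiple k u \<in> identity_component"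
    using comp[of u] by blast
  then show False
    using vanish[of "int_multiple k u"] additive_int_multiple[OF f(1)] f(3) by simp
qed

theorem theorem2p1:
  fixes S :: "'a::{topological_ab_group_add, t2_space} set"
  assumes "abelian_Lie_group TYPE('a)"
    and "finite_index (identity_component :: 'a set)"
    and "finitely_generated_subsemigroup S"
    and "somewhere_dense S"
  shows "is_subgroup (closure S) \<and> identity_component \<subseteq> closure S"
proof -
  obtain A where A: "finite A" "S = semigroup_generated A"
    using assms(3) by (auto simp: finitely_generated_subsemigroup_def)
  obtain U u where U: "open U" "u \<in> U" "U \<subseteq> closure S"
    using assms(4) by (auto simp: somewhere_dense_def)
  have add_T: "x + y \<in> closure S" if "x \<in> closure S" "y \<in> closure S" for x y
    using closure_add_mem that unfolding A by (metis semigroup_generated.add)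
  obtain n where n: "n > 0" "- int_multiple n u \<in> closure S"
    using somewhere_dense_contains_minus_multiple[OF A(1) assms(2) U[unfolded A]] A by auto
  \<comment> \<open>Adding \<open>n - 1\<close> copies of \<open>u\<close> to the element just
    obtained gives \<open>- u\<close>. The case \<open>n = 1\<close> is separate because 0 is not
    yet known to lie in the closure.\<close>
  have "- u \<in> closure S"
  proof (cases "n = 1")
    case False
    then have "int_multiple (n - 1) u \<in> closure S"
      using n(1) U add_T by (intro int_multiple_mem) auto
    then have "- int_multiple n u + int_multiple (n - 1) u \<in> closure S"
      using add_T n(2) by blast
    then show ?thesis by (simp add: int_multiple_minus_1)
  qed (use n in simp)
  \<comment> \<open>Writing \<open>x\<close> as \<open>- u + (u + x)\<close> shows that 0 is now an
    interior point of the closure.\<close>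
  then have "{x. u + x \<in> U} \<subseteq> closure S"
    using U(3) add_T[of "- u"] by force
  with U show ?thesis
    using closed_under_add_is_subgroup[OF assms(2) add_T] open_translation[OF U(1), of u] by auto
qed

end
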